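(* Consider the system $$\dot x=F(x,\mu)+G(x,\mu)\zeta,\qquad \dot\zeta=q(x,\zeta,\mu)+b(x,\zeta,\mu)u,$$ where $\dot x=F(x,\mu)$ satisfies the Uniform Lyapunov Property with data $(\mathcal A,c,V)$, and let $d\ge1$, $\sigma>0$ and the threshold $\eta>0$ be as in the context. Then there exists a choice of $\bar k>0$ such that, for every $\mu\in\mathcal P$, along any trajectory of the closed loop of this system with the ternary switched controller with parameters $(\bar k,\eta)$ which starts in $S=\{(x,\zeta):\sigma\le W(x,\zeta)\le c^2+d^2+1\}$, one has $\dot W(x(t),\zeta(t))<0$ whenever $(x(t),\zeta(t))\in S$.
   Context: Setting: $x\in\mathbb R^{n-1}$, $\zeta\in\mathbb R$, $u\in\mathbb R$; $\mu$ is an unknown constant parameter in a compact set $\mathcal P$; $F,G,q,b$ are continuous functions of their arguments, and there is $b_0>0$ with $b(x,\zeta,\mu)\ge b_0$ for all $(x,\zeta,\mu)$. Uniform Lyapunov Property (ULP): there exist an open set $\mathcal A\subset\mathbb R^{n-1}$, a real number $c\ge1$ and a continuously differentiable positive definite function $V:\mathcal A\to\mathbb R_+$ such that $\Gamma_{c+1}:=\{x: V(x)\le c+1\}\subset\mathcal A$ and $\frac{\partial V}{\partial x}F(x,\mu)<0$ for all $x\in\Gamma_{c+1}$, $x\neq0$, and all $\mu\in\mathcal P$. Lyapunov function: for $d\ge1$, $$W(x,\zeta)=\frac{cV(x)}{c+1-V(x)}+\frac{d\zeta^2}{d+1-\zeta^2}$$ on $\{x:V(x)<c+1\}\times\{\zeta:\zeta^2<d+1\}$,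 where $W$ is positive definite and proper (each set $\{W\le\ell\}$, $\ell\ge0$, is compact). Let $\Omega_\ell=\{W\le\ell\}$. The constant $\eta$: put $$w(x,\zeta,\mu)=\frac{c(c+1)}{(c+1-V(x))^2}\frac{\partial V}{\partial x}G(x,\mu)+\frac{2d(d+1)}{(d+1-\zeta^2)^2}q(x,\zeta,\mu).$$ The constant $\eta>0$ is such that $\frac{c}{c+1}\frac{\partial V}{\partial x}F(x,\mu)+w(x,\zeta,\mu)\zeta<0$ for all $(x,\zeta)\in S$ with $|\zeta|<\eta$ and all $\mu\in\mathcal P$ (such $\eta$ exists by continuity and the ULP), and small enough that the sets $\{(x,\zeta)\in\Omega_{c^2+d^2+1}:\zeta\ge\eta\}$ and $\{(x,\zeta)\in\Omega_{c^2+d^2+1}:\zeta\le-\eta\}$ are nonempty. Ternary switched controller with parameters $(\bar k,\eta)$: $u(0)=-\bar k$ if $\zeta(0)\ge\eta$, $u(0)=0$ if $|\zeta(0)|<\eta$, $u(0)=\bar k$ if $\zeta(0)\le-\eta$. For $t\ge0$, the value $u(t^+)$ right after time $t$ is: - $-\bar k$ if ($u(t)=0$ and $\zeta(t)\ge\eta$) or ($u(t)=-\bar k$ and $\zeta(t)>\eta/2$); - $0$ if ($u(t)=-\bar k$ and $\zeta(t)\le\eta/2$) or ($u(t)=\bar k$ and $\zeta(t)\ge-\eta/2$) or ($u(t)=0$ and $|\zeta(t)|<\eta$); - $\bar k$ if ($u(t)=0$ and $\zeta(t)\le-\eta$) or ($u(t)=\bar k$ and $\zeta(t)<-\eta/2$).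 So $u$ is constant between switching instants. $\dot W$ at time $t$ denotes $\frac{\partial W}{\partial x}\dot x+\frac{\partial W}{\partial\zeta}\dot\zeta$ evaluated at the current state with the control value $u(t^+)$ (i.e. the right derivative of $W$ along the trajectory). *)

theory Defs
  imports "HOL-Analysis.Analysis"
begin

definition positive_definite_on :: "'a::real_normed_vector set \<Rightarrow> ('a \<Rightarrow> real) \<Rightarrow> bool" where
  "positive_definite_on A V \<longleftrightarrow> 0 \<in> A \<and> V 0 = 0 \<and> (\<forall>x\<in>A. x \<noteq> 0 \<longrightarrow> V x > 0)"

definition continuously_differentiable_on :: "'a::real_inner set \<Rightarrow> ('a \<Rightarrow> real) \<Rightarrow> bool" where
  "continuously_differentiable_on A V \<longleftrightarrow>
     (\<exists>g. (\<forall>x\<in>A. GDERIV V x :> g x) \<and> continuous_on A g)"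

(* V is a function on A only.  It is represented by a total function that exceeds c + 1
   outside A, which is what the inclusion of the sublevel set in A expresses; so sets such as
   {x. V x < c + 1} need no further restriction to A.
   The term frechet_derivative V (at x) v is the product (dV/dx) v. *)
definition uniform_lyapunov_property ::
  "(real ^ 'n \<Rightarrow> 'p \<Rightarrow> real ^ 'n) \<Rightarrow> 'p set \<Rightarrow> (real ^ 'n) set \<Rightarrow> real \<Rightarrow> (real ^ 'n \<Rightarrow> real) \<Rightarrow> bool"
where
  "uniform_lyapunov_property F P A c V \<longleftrightarrow>
     open A \<and> c \<ge> 1 \<and> continuously_differentiable_on A V \<and> positive_definite_on A V \<and>
     {x. V x \<le> c + 1} \<subseteq> A \<and>
     (\<forall>x. V x \<le> c + 1 \<and> x \<noteq> 0 \<longrightarrow> (\<forall>\<mu>\<in>P. frechet_derivative V (at x) (F x \<mu>) < 0))"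

definition lyap_W :: "real \<Rightarrow> real \<Rightarrow> (real ^ 'n \<Rightarrow> real) \<Rightarrow> real ^ 'n \<Rightarrow> real \<Rightarrow> real" where
  "lyap_W c d V x \<zeta> = c * V x / (c + 1 - V x) + d * \<zeta>\<^sup>2 / (d + 1 - \<zeta>\<^sup>2)"

definition lyap_dom :: "real \<Rightarrow> real \<Rightarrow> (real ^ 'n \<Rightarrow> real) \<Rightarrow> ((real ^ 'n) \<times> real) set" where
  "lyap_dom c d V = {x. V x < c + 1} \<times> {\<zeta>. \<zeta>\<^sup>2 < d + 1}"

definition lyap_sublevel :: "real \<Rightarrow> real \<Rightarrow> (real ^ 'n \<Rightarrow> real) \<Rightarrow> real \<Rightarrow> ((real ^ 'n) \<times> real) set" where
  "lyap_sublevel c d V l = {(x, \<zeta>) \<in> lyap_dom c d V. lyap_W c d V x \<zeta> \<le> l}"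

definition lyap_shell :: "real \<Rightarrow> real \<Rightarrow> (real ^ 'n \<Rightarrow> real) \<Rightarrow> real \<Rightarrow> ((real ^ 'n) \<times> real) set" where
  "lyap_shell c d V \<sigma> =
     {(x, \<zeta>) \<in> lyap_dom c d V. \<sigma> \<le> lyap_W c d V x \<zeta> \<and> lyap_W c d V x \<zeta> \<le> c\<^sup>2 + d\<^sup>2 + 1}"

(* Each set {W \<le> l} is compact.  This does not follow from the uniform Lyapunov property,
   which does not ask the sublevel sets of V to be compact. *)
definition lyap_proper :: "real \<Rightarrow> real \<Rightarrow> (real ^ 'n \<Rightarrow> real) \<Rightarrow> bool" where
  "lyap_proper c d V \<longleftrightarrow> (\<forall>l\<ge>0. compact (lyap_sublevel c d V l))"

definition cross_term ::
  "real \<Rightarrow> real \<Rightarrow> (real ^ 'n \<Rightarrow> real) \<Rightarrow> (real ^ 'n \<Rightarrow> 'p \<Rightarrow> real ^ 'n) \<Rightarrow>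
   (real ^ 'n \<Rightarrow> real \<Rightarrow> 'p \<Rightarrow> real) \<Rightarrow> real ^ 'n \<Rightarrow> real \<Rightarrow> 'p \<Rightarrow> real"
where
  "cross_term c d V G q x \<zeta> \<mu> =
     c * (c + 1) / (c + 1 - V x)\<^sup>2 * frechet_derivative V (at x) (G x \<mu>) +
     2 * d * (d + 1) / (d + 1 - \<zeta>\<^sup>2)\<^sup>2 * q x \<zeta> \<mu>"

definition admissible_threshold ::
  "(real ^ 'n \<Rightarrow> 'p \<Rightarrow> real ^ 'n) \<Rightarrow> (real ^ 'n \<Rightarrow> 'p \<Rightarrow> real ^ 'n) \<Rightarrow>
   (real ^ 'n \<Rightarrow> real \<Rightarrow> 'p \<Rightarrow> real) \<Rightarrow> 'p set \<Rightarrow>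
   real \<Rightarrow> real \<Rightarrow> (real ^ 'n \<Rightarrow> real) \<Rightarrow> real \<Rightarrow> real \<Rightarrow> bool"
where
  "admissible_threshold F G q P c d V \<sigma> \<eta> \<longleftrightarrow>
     \<eta> > 0 \<and>
     (\<forall>(x, \<zeta>) \<in> lyap_shell c d V \<sigma>. \<bar>\<zeta>\<bar> < \<eta> \<longrightarrow>
        (\<forall>\<mu>\<in>P. c / (c + 1) * frechet_derivative V (at x) (F x \<mu>) +
                 cross_term c d V G q x \<zeta> \<mu> * \<zeta> < 0)) \<and>
     {(x, \<zeta>) \<in> lyap_sublevel c d V (c\<^sup>2 + d\<^sup>2 + 1). \<zeta> \<ge> \<eta>} \<noteq> {} \<and>
     {(x, \<zeta>) \<in> lyap_sublevel c d V (c\<^sup>2 + d\<^sup>2 + 1). \<zeta> \<le> - \<eta>} \<noteq> {}"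

definition ternary_init :: "real \<Rightarrow> real \<Rightarrow> real \<Rightarrow> real" where
  "ternary_init k \<eta> z = (if z \<ge> \<eta> then - k else if z \<le> - \<eta> then k else 0)"

(* Value of the control right after an instant at which it equals v and \<zeta> equals z.
   For k, \<eta> > 0 and v in {-k, 0, k} the last branch is reached exactly if
   v = -k and z \<le> \<eta>/2, or v = k and z \<ge> -\<eta>/2, or v = 0 and |z| < \<eta>. *)
definition ternary_next :: "real \<Rightarrow> real \<Rightarrow> real \<Rightarrow> real \<Rightarrow> real" where
  "ternary_next k \<eta> v z =
     (if v = 0 \<and> z \<ge> \<eta> \<or> v = - k \<and> z > \<eta> / 2 then - k
      else if v = 0 \<and> z \<le> - \<eta> \<or> v = k \<and> z < - \<eta> / 2 then k
      else 0)"

(* Trajectories live on [0, T) with 0 < T \<le> \<infinity> and need not be maximal.  The control u is piecewise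
   constant and left-continuous: at a switching instant t, u t is still the value before the
   switch.  Hence \<zeta> has left derivative with control u t and right derivative with
   control u(t+); the two agree except at switching instants. *)
definition closed_loop_trajectory ::
  "(real ^ 'n \<Rightarrow> 'p \<Rightarrow> real ^ 'n) \<Rightarrow> (real ^ 'n \<Rightarrow> 'p \<Rightarrow> real ^ 'n) \<Rightarrow>
   (real ^ 'n \<Rightarrow> real \<Rightarrow> 'p \<Rightarrow> real) \<Rightarrow> (real ^ 'n \<Rightarrow> real \<Rightarrow> 'p \<Rightarrow> real) \<Rightarrow>
   real \<Rightarrow> real \<Rightarrow> 'p \<Rightarrow> ereal \<Rightarrow>
   (real \<Rightarrow> real ^ 'n) \<Rightarrow> (real \<Rightarrow> real) \<Rightarrow> (real \<Rightarrow> real) \<Rightarrow> bool"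
where
  "closed_loop_trajectory F G q b k \<eta> \<mu> T x \<zeta> u \<longleftrightarrow>
     0 < T \<and> u 0 = ternary_init k \<eta> (\<zeta> 0) \<and>
     (\<forall>t. 0 \<le> t \<and> ereal t < T \<longrightarrow>
        u t \<in> {- k, 0, k} \<and>
        (\<forall>\<^sub>F s in at_right t. u s = ternary_next k \<eta> (u t) (\<zeta> t)) \<and>
        (x has_vector_derivative F (x t) \<mu> + \<zeta> t *\<^sub>R G (x t) \<mu>) (at t within {0..}) \<and>
        (\<zeta> has_real_derivative
           q (x t) (\<zeta> t) \<mu> + b (x t) (\<zeta> t) \<mu> * ternary_next k \<eta> (u t) (\<zeta> t)) (at_right t)) \<and>
     (\<forall>t. 0 < t \<and> ereal t < T \<longrightarrow>
        (\<forall>\<^sub>F s in at_left t. u s = u t) \<and>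
        (\<zeta> has_real_derivative q (x t) (\<zeta> t) \<mu> + b (x t) (\<zeta> t) \<mu> * u t) (at_left t))"

(* (dW/dx) x' + (dW/d\<zeta>) \<zeta>' at the state (x, \<zeta>) with control value v. *)
definition lyap_W_dot ::
  "real \<Rightarrow> real \<Rightarrow> (real ^ 'n \<Rightarrow> real) \<Rightarrow>
   (real ^ 'n \<Rightarrow> 'p \<Rightarrow> real ^ 'n) \<Rightarrow> (real ^ 'n \<Rightarrow> 'p \<Rightarrow> real ^ 'n) \<Rightarrow>
   (real ^ 'n \<Rightarrow> real \<Rightarrow> 'p \<Rightarrow> real) \<Rightarrow> (real ^ 'n \<Rightarrow> real \<Rightarrow> 'p \<Rightarrow> real) \<Rightarrow>
   'p \<Rightarrow> real ^ 'n \<Rightarrow> real \<Rightarrow> real \<Rightarrow> real"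
where
  "lyap_W_dot c d V F G q b \<mu> x \<zeta> v =
     frechet_derivative (\<lambda>y. lyap_W c d V y \<zeta>) (at x) (F x \<mu> + \<zeta> *\<^sub>R G x \<mu>) +
     deriv (\<lambda>z. lyap_W c d V x z) \<zeta> * (q x \<zeta> \<mu> + b x \<zeta> \<mu> * v)"

end

theory Submission
  imports Defs
begin

text \<open>
  Along the system, \<open>W'\<close> splits into three parts: the decay term
  \<open>c (c + 1) / (c + 1 - V x)\<^sup>2 * V' F\<close>, the cross term \<open>w \<zeta>\<close>, and the control term
  \<open>2 d (d + 1) / (d + 1 - \<zeta>\<^sup>2)\<^sup>2 * \<zeta> b v\<close> (lemma \<open>lyap_W_dot_eq\<close>).  As \<open>V \<ge> 0\<close> and \<open>V' F \<le> 0\<close>,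
  the decay term is at most \<open>c / (c + 1) * V' F\<close>.

  If the control value is \<open>0\<close>, then \<open>\<bar>\<zeta>\<bar> < \<eta>\<close>, and \<open>W' < 0\<close> is exactly what the choice of \<open>\<eta>\<close>
  provides.  If the control value is \<open>-k\<close> or \<open>k\<close>, then \<open>\<zeta>\<close> has the opposite sign and
  \<open>\<bar>\<zeta>\<bar> > \<eta> / 2\<close>; so the control term is at most \<open>- \<bar>\<zeta>\<bar> * 2 d / (d + 1) * b0 k\<close>, while the cross
  term is at most \<open>\<bar>\<zeta>\<bar> M\<close>, where \<open>M\<close> bounds \<open>\<bar>w\<bar>\<close> on the compact set
  \<open>{W \<le> c\<^sup>2 + d\<^sup>2 + 1} \<times> P\<close> (lemma \<open>cross_term_bounded\<close>).  Any \<open>k\<close> with \<open>2 d / (d + 1) * b0 k > M\<close>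
  therefore works, and it depends neither on \<open>\<mu>\<close> nor on the trajectory.

  What remains is the stated relation between the control value and \<open>\<zeta>\<close> (lemma
  \<open>closed_loop_control_cases\<close>).  The switching rule alone does not give it: from \<open>u = -k\<close> it
  would switch to \<open>0\<close> even at a very negative \<open>\<zeta>\<close>.  It holds along trajectories because
  \<open>\<zeta>\<close> is continuous and so cannot jump over the interval between the thresholds.
\<close>

text \<open>
  For \<open>t > 0\<close>, left continuity makes \<open>u\<close> constant just before \<open>t\<close>.  No switch happens there, so
  the switching rule maps \<open>u t\<close> to itself at those earlier states.  The strict threshold
  inequalities that this encodes pass to the limit \<open>\<zeta> t\<close> in weak form.  For \<open>t = 0\<close> they come from
  the initialisation.
\<close>

lemma closed_loop_control_before_switch:
  assumes traj: "closed_loop_trajectory F G q b k \<eta> \<mu> T x \<zeta> u"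
    and k: "k > 0" and \<eta>: "\<eta> > 0" and t: "0 \<le> t" "ereal t < T"
  shows "u t = 0 \<and> \<bar>\<zeta> t\<bar> \<le> \<eta> \<or> u t = - k \<and> \<eta> / 2 \<le> \<zeta> t \<or> u t = k \<and> \<zeta> t \<le> - \<eta> / 2"
proof (cases "t = 0")
  case True
  have "u 0 = ternary_init k \<eta> (\<zeta> 0)"
    using traj by (simp add: closed_loop_trajectory_def)
  then show ?thesis
    using k \<eta> True by (auto simp: ternary_init_def)
next
  case False
  then have "t > 0" using t by simp
  have u_range: "u t \<in> {- k, 0, k}"
    using traj t unfolding closed_loop_trajectory_def by blast
  have right: "\<forall>\<^sub>F r in at_right s. u r = ternary_next k \<eta> (u s) (\<zeta> s)" if "0 \<le> s" "s < t" for s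
  proof -
    have "ereal s < T" using that t by (meson ereal_less_le less_imp_le less_eq_ereal_def)
    then show ?thesis
      using traj that unfolding closed_loop_trajectory_def by blast
  qed
  have "\<forall>\<^sub>F s in at_left t. u s = u t"
    using traj t \<open>t > 0\<close> unfolding closed_loop_trajectory_def by blast
  then obtain a where a: "a < t" "\<And>s. a < s \<Longrightarrow> s < t \<Longrightarrow> u s = u t"
    unfolding eventually_at_left_field by blast
  define a' where "a' = max a 0"
  have a': "a' < t" "0 \<le> a'" using a \<open>t > 0\<close> by (auto simp: a'_def)
  have fixed: "ternary_next k \<eta> (u t) (\<zeta> s) = u t" if s: "a' < s" "s < t" for s
  proof -
    have us: "u s = u t" using a s by (simp add: a'_def)
    have "\<forall>\<^sub>F r in at_right s. u r = ternary_next k \<eta> (u t) (\<zeta> s)"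
      using right[of s] s a' us by simp
    moreover have "\<forall>\<^sub>F r in at_right s. u r = u t"
      unfolding eventually_at_right_field using a s by (intro exI[of _ t]) (auto simp: a'_def)
    ultimately have "\<forall>\<^sub>F r in at_right s. ternary_next k \<eta> (u t) (\<zeta> s) = u t"
      by eventually_elim simp
    then show ?thesis by simp
  qed
  have near: "\<forall>\<^sub>F s in at_left t. ternary_next k \<eta> (u t) (\<zeta> s) = u t"
    unfolding eventually_at_left_field using fixed a' by blast
  have "(\<zeta> has_real_derivative q (x t) (\<zeta> t) \<mu> + b (x t) (\<zeta> t) \<mu> * u t) (at_left t)"
    using traj t \<open>t > 0\<close> unfolding closed_loop_trajectory_def by blast
  then have lim: "(\<zeta> \<longlongrightarrow> \<zeta> t) (at_left t)"
    using DERIV_continuous continuous_within by blast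
  have nontriv: "at_left t \<noteq> bot" by simp
  consider "u t = 0" | "u t = - k" | "u t = k" using u_range by blast
  then show ?thesis
  proof cases
    case 1
    have ev: "\<forall>\<^sub>F s in at_left t. \<bar>\<zeta> s\<bar> \<le> \<eta>"
      using near by eventually_elim (use 1 k in \<open>auto simp: ternary_next_def split: if_splits\<close>)
    have "\<bar>\<zeta> t\<bar> \<le> \<eta>"
      by (rule tendsto_upperbound[OF tendsto_rabs[OF lim] ev nontriv])
    with 1 show ?thesis by simp
  next
    case 2
    have ev: "\<forall>\<^sub>F s in at_left t. \<eta> / 2 \<le> \<zeta> s"
      using near by eventually_elim (use 2 k in \<open>auto simp: ternary_next_def split: if_splits\<close>)
    have "\<eta> / 2 \<le> \<zeta> t"
      by (rule tendsto_lowerbound[OF lim ev nontriv])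
    with 2 show ?thesis by simp
  next
    case 3
    have ev: "\<forall>\<^sub>F s in at_left t. \<zeta> s \<le> - \<eta> / 2"
      using near by eventually_elim (use 3 k in \<open>auto simp: ternary_next_def split: if_splits\<close>)
    have "\<zeta> t \<le> - \<eta> / 2"
      by (rule tendsto_upperbound[OF lim ev nontriv])
    with 3 show ?thesis by simp
  qed
qed

text \<open>
  Applying the switching rule once more sharpens the weak inequalities: at a threshold itself
  the control switches, and the strict inequality of the new mode holds there.
\<close>

lemma closed_loop_control_cases:
  assumes "closed_loop_trajectory F G q b k \<eta> \<mu> T x \<zeta> u"
    and k: "k > 0" and \<eta>: "\<eta> > 0" and "0 \<le> t" "ereal t < T"
  obtains "ternary_next k \<eta> (u t) (\<zeta> t) = 0" "\<bar>\<zeta> t\<bar> < \<eta>"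
  | "ternary_next k \<eta> (u t) (\<zeta> t) = - k" "\<eta> / 2 < \<zeta> t"
  | "ternary_next k \<eta> (u t) (\<zeta> t) = k" "\<zeta> t < - \<eta> / 2"
proof -
  consider "u t = 0" "\<bar>\<zeta> t\<bar> \<le> \<eta>" | "u t = - k" "\<eta> / 2 \<le> \<zeta> t" | "u t = k" "\<zeta> t \<le> - \<eta> / 2"
    using closed_loop_control_before_switch[OF assms] by blast
  then show thesis
  proof cases
    case 1
    consider "\<zeta> t \<ge> \<eta>" | "\<zeta> t \<le> - \<eta>" | "\<bar>\<zeta> t\<bar> < \<eta>" by linarith
    then show thesis
    proof cases
      case upper: 1
      with 1 \<eta> show thesis by (intro that(2)) (auto simp: ternary_next_def)
    next
      case lower: 2
      with 1 \<eta> show thesis by (intro that(3)) (auto simp: ternary_next_def)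
    next
      case between: 3
      with 1 k show thesis by (intro that(1)) (auto simp: ternary_next_def)
    qed
  next
    case 2
    then show thesis
      using k \<eta> that(1,2) by (cases "\<zeta> t = \<eta> / 2") (auto simp: ternary_next_def)
  next
    case 3
    then show thesis
      using k \<eta> that(1,3) by (cases "\<zeta> t = - \<eta> / 2") (auto simp: ternary_next_def)
  qed
qed

lemma lyap_W_dot_eq:
  fixes V :: "real ^ 'n \<Rightarrow> real"
  assumes V: "V differentiable (at x)" and dom: "(x, \<zeta>) \<in> lyap_dom c d V"
  shows "lyap_W_dot c d V F G q b \<mu> x \<zeta> v =
    c * (c + 1) / (c + 1 - V x)\<^sup>2 * frechet_derivative V (at x) (F x \<mu>)
    + cross_term c d V G q x \<zeta> \<mu> * \<zeta>
    + 2 * d * (d + 1) / (d + 1 - \<zeta>\<^sup>2)\<^sup>2 * (\<zeta> * b x \<zeta> \<mu> * v)"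
proof -
  let ?V' = "frechet_derivative V (at x)"
  let ?a = "c * (c + 1) / (c + 1 - V x)\<^sup>2" and ?e = "2 * d * (d + 1) / (d + 1 - \<zeta>\<^sup>2)\<^sup>2"
  have V': "(V has_derivative ?V') (at x)"
    using V frechet_derivative_works by blast
  have nz: "c + 1 - V x \<noteq> 0" "d + 1 - \<zeta>\<^sup>2 \<noteq> 0"
    using dom by (auto simp: lyap_dom_def)
  have "((\<lambda>y. lyap_W c d V y \<zeta>) has_derivative (\<lambda>h. ?a * ?V' h)) (at x)"
    unfolding lyap_W_def
    by (rule derivative_eq_intros V' nz refl)+
       (use nz in \<open>auto simp: fun_eq_iff field_simps power2_eq_square\<close>)
  then have 1: "frechet_derivative (\<lambda>y. lyap_W c d V y \<zeta>) (at x) = (\<lambda>h. ?a * ?V' h)"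
    by (rule frechet_derivative_at[symmetric])
  have "((\<lambda>z. lyap_W c d V x z) has_real_derivative ?e * \<zeta>) (at \<zeta>)"
    unfolding lyap_W_def
    by (rule derivative_eq_intros nz refl)+
       (use nz in \<open>auto simp: field_simps power2_eq_square\<close>)
  then have 2: "deriv (\<lambda>z. lyap_W c d V x z) \<zeta> = ?e * \<zeta>"
    by (rule DERIV_imp_deriv)
  have 3: "?V' (F x \<mu> + \<zeta> *\<^sub>R G x \<mu>) = ?V' (F x \<mu>) + \<zeta> * ?V' (G x \<mu>)"
    using has_derivative_linear[OF V'] by (simp add: linear_add linear_scale)
  show ?thesis
    unfolding lyap_W_dot_def cross_term_def 1 2 3
    by (simp add: algebra_simps add_divide_distrib)
qed

lemma cross_term_bounded:
  fixes V :: "real ^ 'n \<Rightarrow> real" and P :: "'p::metric_space set"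
  assumes P: "compact P"
    and G: "continuous_on (UNIV \<times> P) (\<lambda>(x, \<mu>). G x \<mu>)"
    and q: "continuous_on (UNIV \<times> UNIV \<times> P) (\<lambda>(x, \<zeta>, \<mu>). q x \<zeta> \<mu>)"
    and V: "continuously_differentiable_on A V" and sub: "{x. V x \<le> c + 1} \<subseteq> A"
    and K: "compact K" "K \<subseteq> lyap_dom c d V"
  obtains M where "M > 0" "\<And>x \<zeta> \<mu>. (x, \<zeta>) \<in> K \<Longrightarrow> \<mu> \<in> P \<Longrightarrow> \<bar>cross_term c d V G q x \<zeta> \<mu>\<bar> \<le> M"
proof -
  obtain g where g: "\<And>x. x \<in> A \<Longrightarrow> GDERIV V x :> g x" "continuous_on A g"
    using V by (auto simp: continuously_differentiable_on_def)
  have in_A: "fst (fst z) \<in> A" if "z \<in> K \<times> P" for z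
    using that K sub by (force simp: lyap_dom_def)
  have "continuous_on A V"
    using g(1) by (meson continuous_at_imp_continuous_on gderiv_def has_derivative_continuous)
  note cont_A = continuous_on_compose2[OF this _ image_subsetI[OF in_A]]
    continuous_on_compose2[OF g(2) _ image_subsetI[OF in_A]]
  have contG: "continuous_on (K \<times> P) (\<lambda>z. G (fst (fst z)) (snd z))"
    by (rule continuous_on_compose2[OF G, where f = "\<lambda>z. (fst (fst z), snd z)", simplified])
       (auto intro!: continuous_intros)
  have contq: "continuous_on (K \<times> P) (\<lambda>z. q (fst (fst z)) (snd (fst z)) (snd z))"
    by (rule continuous_on_compose2[OF q, where f = "\<lambda>z. (fst (fst z), snd (fst z), snd z)", simplified])
       (auto intro!: continuous_intros)
  have nz: "c + 1 - V (fst (fst z)) \<noteq> 0" "d + 1 - (snd (fst z))\<^sup>2 \<noteq> 0" if "z \<in> K \<times> P" for z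
    using that K by (force simp: lyap_dom_def)+
  let ?w = "\<lambda>z. c * (c + 1) / (c + 1 - V (fst (fst z)))\<^sup>2 * (G (fst (fst z)) (snd z) \<bullet> g (fst (fst z)))
     + 2 * d * (d + 1) / (d + 1 - (snd (fst z))\<^sup>2)\<^sup>2 * q (fst (fst z)) (snd (fst z)) (snd z)"
  have "continuous_on (K \<times> P) ?w"
    by (intro continuous_intros cont_A contG contq) (use nz in auto)
  then have "bounded (?w ` (K \<times> P))"
    using P K by (intro compact_imp_bounded compact_continuous_image compact_Times)
  then obtain M where M: "M > 0" and bd: "\<forall>y \<in> ?w ` (K \<times> P). norm y \<le> M"
    unfolding bounded_pos by (elim exE conjE)
  have w_le: "\<bar>?w z\<bar> \<le> M" if "z \<in> K \<times> P" for z
    using bspec[OF bd imageI[OF that]] by (simp only: real_norm_def)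
  show thesis
  proof (rule that[OF M])
    fix x \<zeta> \<mu> assume z: "(x, \<zeta>) \<in> K" "\<mu> \<in> P"
    then have "GDERIV V x :> g x" using g(1) in_A[of "((x, \<zeta>), \<mu>)"] by simp
    then have "frechet_derivative V (at x) = (\<lambda>h. h \<bullet> g x)"
      unfolding gderiv_def by (rule frechet_derivative_at[symmetric])
    then show "\<bar>cross_term c d V G q x \<zeta> \<mu>\<bar> \<le> M"
      using w_le[of "((x, \<zeta>), \<mu>)"] z by (simp add: cross_term_def)
  qed
qed

text \<open>
  At the origin the decay inequality of the uniform Lyapunov property is silent; there the
  derivative of \<open>V\<close> vanishes, as \<open>V\<close> has a minimum.
\<close>

lemma uniform_lyapunov_property_nonpos:
  assumes ulp: "uniform_lyapunov_property F P A c V" and x: "V x \<le> c + 1" and \<mu>: "\<mu> \<in> P"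
  shows "frechet_derivative V (at x) (F x \<mu>) \<le> 0"
proof (cases "x = 0")
  case True
  have A: "open A" "0 \<in> A" and min: "\<And>y. y \<in> A \<Longrightarrow> V 0 \<le> V y"
    using ulp by (auto simp: uniform_lyapunov_property_def positive_definite_on_def
        intro: less_imp_le)
  obtain D where D: "(V has_derivative D) (at 0)"
    using ulp A by (auto simp: uniform_lyapunov_property_def continuously_differentiable_on_def
        gderiv_def)
  have "D = (\<lambda>h. 0)"
    using differential_zero_maxmin[OF A(2,1) D] min by blast
  then show ?thesis
    using True frechet_derivative_at[OF D] by simp
next
  case False
  then show ?thesis
    using ulp x \<mu> by (auto simp: uniform_lyapunov_property_def intro: less_imp_le)
qed

theorem proposition3:
  fixes F G :: "real ^ 'n \<Rightarrow> 'p::metric_space \<Rightarrow> real ^ 'n"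
    and q b :: "real ^ 'n \<Rightarrow> real \<Rightarrow> 'p \<Rightarrow> real"
    and P :: "'p set"
    and A :: "(real ^ 'n) set"
    and V :: "real ^ 'n \<Rightarrow> real"
    and b0 c d \<sigma> \<eta> :: real
  assumes "compact P"
    and "continuous_on (UNIV \<times> P) (\<lambda>(x, \<mu>). F x \<mu>)"
    and "continuous_on (UNIV \<times> P) (\<lambda>(x, \<mu>). G x \<mu>)"
    and "continuous_on (UNIV \<times> UNIV \<times> P) (\<lambda>(x, \<zeta>, \<mu>). q x \<zeta> \<mu>)"
    and "continuous_on (UNIV \<times> UNIV \<times> P) (\<lambda>(x, \<zeta>, \<mu>). b x \<zeta> \<mu>)"
    and "b0 > 0"
    and "\<And>x \<zeta> \<mu>. \<mu> \<in> P \<Longrightarrow> b x \<zeta> \<mu> \<ge> b0"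
    and "uniform_lyapunov_property F P A c V"
    and "d \<ge> 1"
    and "lyap_proper c d V"
    and "\<sigma> > 0"
    and "admissible_threshold F G q P c d V \<sigma> \<eta>"
  shows "\<exists>k>0. \<forall>\<mu>\<in>P. \<forall>T x \<zeta> u.
           closed_loop_trajectory F G q b k \<eta> \<mu> T x \<zeta> u \<longrightarrow>
           (x 0, \<zeta> 0) \<in> lyap_shell c d V \<sigma> \<longrightarrow>
           (\<forall>t. 0 \<le> t \<and> ereal t < T \<and> (x t, \<zeta> t) \<in> lyap_shell c d V \<sigma> \<longrightarrow>
                lyap_W_dot c d V F G q b \<mu> (x t) (\<zeta> t) (ternary_next k \<eta> (u t) (\<zeta> t)) < 0)"
proof -
  note ulp = \<open>uniform_lyapunov_property F P A c V\<close>
  have c: "c \<ge> 1" and sub: "{x. V x \<le> c + 1} \<subseteq> A" and V: "continuously_differentiable_on A V"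
    and pos: "positive_definite_on A V"
    using ulp by (auto simp: uniform_lyapunov_property_def)
  have \<eta>: "\<eta> > 0" using assms(12) by (simp add: admissible_threshold_def)
  let ?K = "lyap_sublevel c d V (c\<^sup>2 + d\<^sup>2 + 1)"
  have "compact ?K" using assms(10) by (simp add: lyap_proper_def)
  moreover have "?K \<subseteq> lyap_dom c d V" by (auto simp: lyap_sublevel_def)
  ultimately obtain M where M: "M > 0"
    "\<And>x \<zeta> \<mu>. (x, \<zeta>) \<in> ?K \<Longrightarrow> \<mu> \<in> P \<Longrightarrow> \<bar>cross_term c d V G q x \<zeta> \<mu>\<bar> \<le> M"
    using cross_term_bounded[OF assms(1,3,4) V sub] by blast
  \<comment> \<open>The factor \<open>2 d (d + 1) / (d + 1 - \<zeta>\<^sup>2)\<^sup>2\<close> is smallest at \<open>\<zeta> = 0\<close>, where it equals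
    \<open>2 d / (d + 1) \<ge> 1\<close>; so \<open>b0 k > M\<close> suffices.\<close>
  define k where "k = (M + 1) / b0"
  have k: "k > 0" "b0 * k > M" using M(1) \<open>b0 > 0\<close> by (auto simp: k_def)
  show ?thesis
  proof (intro exI[of _ k] conjI ballI allI impI, fact k(1), elim conjE)
    fix \<mu> T x \<zeta> u t
    assume \<mu>: "\<mu> \<in> P" and traj: "closed_loop_trajectory F G q b k \<eta> \<mu> T x \<zeta> u"
      and t: "0 \<le> t" "ereal t < T" and S: "(x t, \<zeta> t) \<in> lyap_shell c d V \<sigma>"
    define X Z v where "X = x t" and "Z = \<zeta> t" and "v = ternary_next k \<eta> (u t) (\<zeta> t)"
    have XZ: "(X, Z) \<in> lyap_shell c d V \<sigma>" "(X, Z) \<in> lyap_dom c d V" "(X, Z) \<in> ?K"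
      using S by (auto simp: X_def Z_def lyap_shell_def lyap_sublevel_def)
    have VX: "V X < c + 1" and Z2: "Z\<^sup>2 < d + 1" using XZ by (auto simp: lyap_dom_def)
    have XA: "X \<in> A" using sub VX by auto
    have V_nonneg: "V X \<ge> 0"
      using pos XA by (cases "X = 0") (auto simp: positive_definite_on_def intro: less_imp_le)
    have diff: "V differentiable (at X)"
      using V XA unfolding continuously_differentiable_on_def gderiv_def differentiable_def by blast
    let ?V' = "frechet_derivative V (at X)" and ?w = "cross_term c d V G q X Z \<mu>"
    let ?a = "c * (c + 1) / (c + 1 - V X)\<^sup>2" and ?e = "2 * d * (d + 1) / (d + 1 - Z\<^sup>2)\<^sup>2"
    have V'F: "?V' (F X \<mu>) \<le> 0"
      using uniform_lyapunov_property_nonpos[OF ulp _ \<mu>] VX by simp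
    have "(c + 1 - V X)\<^sup>2 \<le> (c + 1)\<^sup>2" "(c + 1 - V X)\<^sup>2 > 0"
      using VX V_nonneg by (auto intro!: power_mono)
    then have "c * (c + 1) / (c + 1)\<^sup>2 \<le> ?a"
      using c by (intro divide_left_mono) auto
    then have "c / (c + 1) \<le> ?a" using c by (simp add: power2_eq_square)
    then have decay: "?a * ?V' (F X \<mu>) \<le> c / (c + 1) * ?V' (F X \<mu>)"
      using V'F by (rule mult_right_mono_neg)
    have "(d + 1 - Z\<^sup>2)\<^sup>2 \<le> (d + 1)\<^sup>2" "(d + 1 - Z\<^sup>2)\<^sup>2 > 0"
      using Z2 by (auto intro!: power_mono)
    moreover have "(d + 1)\<^sup>2 \<le> 2 * d * (d + 1)"
      using \<open>d \<ge> 1\<close> by (simp add: power2_eq_square)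
    ultimately have e: "?e \<ge> 1" by simp
    have "lyap_W_dot c d V F G q b \<mu> X Z v =
        ?a * ?V' (F X \<mu>) + ?w * Z + ?e * (Z * b X Z \<mu> * v)"
      by (rule lyap_W_dot_eq[OF diff XZ(2)])
    also have "\<dots> < 0"
    proof -
      \<comment> \<open>The control opposes \<open>\<zeta>\<close>, so that both nonzero modes reduce to the same estimate.\<close>
      have opposed: ?thesis if Zv: "Z * v = - (\<bar>Z\<bar> * k)" and "Z \<noteq> 0"
      proof -
        have "M < b0 * k" by (fact k(2))
        also have "\<dots> \<le> b X Z \<mu> * k"
          using assms(7)[OF \<mu>] k(1) by simp
        also have "\<dots> \<le> ?e * (b X Z \<mu> * k)"
          using mult_right_mono[OF e, of "b X Z \<mu> * k"] assms(7)[OF \<mu>, of X Z] \<open>b0 > 0\<close> k(1)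
          by simp
        finally have gain: "M < ?e * (b X Z \<mu> * k)" .
        have "?w * Z \<le> \<bar>?w\<bar> * \<bar>Z\<bar>"
          using abs_ge_self[of "?w * Z"] by (simp only: abs_mult)
        also have "\<dots> \<le> M * \<bar>Z\<bar>"
          using M(2)[OF XZ(3) \<mu>] by (rule mult_right_mono) simp
        also have "\<dots> < ?e * (b X Z \<mu> * k) * \<bar>Z\<bar>"
          using gain \<open>Z \<noteq> 0\<close> by (intro mult_strict_right_mono) auto
        also have "\<dots> = - (?e * (b X Z \<mu> * (Z * v)))" by (simp add: Zv)
        finally have "?w * Z + ?e * (Z * b X Z \<mu> * v) < 0" by (simp add: algebra_simps)
        moreover have "?a * ?V' (F X \<mu>) \<le> 0"
          using V'F c by (intro mult_nonneg_nonpos) auto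
        ultimately show ?thesis by linarith
      qed
      from closed_loop_control_cases[OF traj k(1) \<eta> t] show ?thesis
      proof cases
        case 1
        then have "c / (c + 1) * ?V' (F X \<mu>) + ?w * Z < 0"
          using assms(12) XZ(1) \<mu> unfolding admissible_threshold_def Z_def by blast
        with decay 1 show ?thesis by (simp add: v_def)
      next
        case 2
        with \<eta> show ?thesis by (intro opposed) (auto simp: v_def Z_def)
      next
        case 3
        with \<eta> show ?thesis by (intro opposed) (auto simp: v_def Z_def)
      qed
    qed
    finally show "lyap_W_dot c d V F G q b \<mu> (x t) (\<zeta> t) (ternary_next k \<eta> (u t) (\<zeta> t)) < 0"
      by (simp add: X_def Z_def v_def)
  qed
qed

end
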